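(* Let $G$ be a finite simple graph on $n$ vertices. Then \[ \sum_{v\in V(G)} d(v)\cdot\frac{\mathrm{cl}(v) - 1}{\mathrm{cl}(v)} \leq \Bigg(\sum_{v\in V(G)} \frac{\mathrm{cl}(v) - 1}{\mathrm{cl}(v)}\Bigg)^2. \] Equality holds if and only if $G$ is, up to isolated vertices, a complete regular multi-partite graph.
   Context: $d(v)$ is the degree of $v$; $\mathrm{cl}(v)$ denotes the order of a largest clique of $G$ containing the vertex $v$ (so $\mathrm{cl}(v)=1$ for an isolated vertex). *)

theory Defs
  imports Complex_Main "HOL-Library.Disjoint_Sets" "Graph_Theory.Digraph_Component"
begin

text \<open>
  Finite simple graphs are the finite symmetric loop-free digraphs without parallel arcs
  of the locale \<^locale>\<open>graph\<close>: an undirected edge is a pair of opposite arcs, so the degree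
  of a vertex is its \<^const>\<open>out_degree\<close>.
\<close>

definition clique :: "('a, 'b) pre_digraph \<Rightarrow> 'a set \<Rightarrow> bool" where
  "clique G C \<longleftrightarrow> C \<subseteq> verts G \<and> pairwise (\<lambda>u v. u \<rightarrow>\<^bsub>G\<^esub> v) C"

definition cl :: "('a, 'b) pre_digraph \<Rightarrow> 'a \<Rightarrow> nat" where
  "cl G v = Max {card C |C. clique G C \<and> v \<in> C}"

definition regular :: "('a, 'b) pre_digraph \<Rightarrow> bool" where
  "regular G \<longleftrightarrow> (\<exists>k. \<forall>v\<in>verts G. out_degree G v = k)"

text \<open>
  The number of parts is arbitrary. In particular an edgeless graph is complete multipartite
  (with one part, or none if there are no vertices).
\<close>

definition complete_multipartite :: "('a, 'b) pre_digraph \<Rightarrow> bool" where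
  "complete_multipartite G \<longleftrightarrow>
     (\<exists>P. partition_on (verts G) P \<and>
        (\<forall>u\<in>verts G. \<forall>v\<in>verts G. u \<rightarrow>\<^bsub>G\<^esub> v \<longleftrightarrow> \<not> (\<exists>A\<in>P. u \<in> A \<and> v \<in> A)))"

definition isolated_verts :: "('a, 'b) pre_digraph \<Rightarrow> 'a set" where
  "isolated_verts G = {v \<in> verts G. out_degree G v = 0}"

definition up_to_isolated_verts ::
    "(('a, 'b) pre_digraph \<Rightarrow> bool) \<Rightarrow> ('a, 'b) pre_digraph \<Rightarrow> bool" where
  "up_to_isolated_verts Q G \<longleftrightarrow> (\<exists>I \<subseteq> isolated_verts G. Q (G \<restriction> (verts G - I)))"

end

theory Submission
  imports Defs
begin

text \<open>
  Write \<open>f v = 1 - 1 / cl v\<close> and put the weight \<open>1 / min (f u) (f v)\<close> on every edge \<open>u v\<close>. The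
  Motzkin--Straus argument (shifting mass between two non-adjacent vertices is linear, so the
  support can be shrunk to a clique) shows that the resulting quadratic form is at most the square
  of the total mass. Evaluated at the point \<open>f\<close> itself, each edge contributes
  \<open>max (f u) (f v) \<ge> (f u + f v) / 2\<close>, which is the inequality. In the equality case \<open>f\<close> is an
  interior maximiser on the non-isolated vertices: the first-order condition gives regularity, and
  the second-order condition forces non-adjacency to be transitive.
\<close>

section \<open>Quadratic forms on the nonnegative orthant\<close>

text \<open>Kept bilinear rather than quadratic so that the mixed term \<open>bform a S x y\<close>,
  half the directional derivative for symmetric \<open>a\<close>, is available next to
  \<open>bform a S x x\<close>.\<close>

definition bform :: "('a \<Rightarrow> 'a \<Rightarrow> real) \<Rightarrow> 'a set \<Rightarrow> ('a \<Rightarrow> real) \<Rightarrow> ('a \<Rightarrow> real) \<Rightarrow> real" where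
  "bform a S x y = (\<Sum>u\<in>S. \<Sum>v\<in>S. a u v * x u * y v)"

lemma bform_commute:
  assumes "\<And>u v. a u v = a v u"
  shows "bform a S x y = bform a S y x"
  unfolding bform_def
  by (subst sum.swap) (simp add: assms mult_ac)

lemma bform_add_left: "bform a S (\<lambda>w. x w + t * y w) z = bform a S x z + t * bform a S y z"
  by (simp add: bform_def algebra_simps sum.distrib sum_distrib_left)

lemma bform_add_right: "bform a S z (\<lambda>w. x w + t * y w) = bform a S z x + t * bform a S z y"
  by (simp add: bform_def algebra_simps sum.distrib sum_distrib_left)

text \<open>A polynomial of degree two in \<open>t\<close>: its linear coefficient controls mass
  shifts and the first-order condition, its quadratic one the second-order condition.\<close>

lemma bform_line:
  assumes "\<And>u v. a u v = a v u"
  shows "bform a S (\<lambda>w. x w + t * y w) (\<lambda>w. x w + t * y w)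
           = bform a S x x + 2 * t * bform a S x y + t\<^sup>2 * bform a S y y"
  using bform_commute[of a S y x] assms
  by (simp add: bform_add_left bform_add_right algebra_simps power2_eq_square)

text \<open>For symmetric \<open>a\<close> the row sum is half the partial derivative of the
  quadratic form at \<open>v\<close>.\<close>

lemma bform_unit_right:
  assumes "finite S" "v \<in> S"
  shows "bform a S x (\<lambda>w. of_bool (w = v)) = (\<Sum>u\<in>S. a u v * x u)"
  using assms by (simp add: bform_def of_bool_def if_distrib cong: if_cong)

lemma bform_unit_unit:
  assumes "finite S" "u \<in> S" "v \<in> S"
  shows "bform a S (\<lambda>w. of_bool (w = u)) (\<lambda>w. of_bool (w = v)) = a u v"
  unfolding bform_unit_right[OF assms(1,3)]
  using assms by (simp add: of_bool_def if_distrib cong: if_cong)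

section \<open>The Motzkin-Straus inequality with edge weights\<close>

lemma square_sum_le_card_mult_sum_squares:
  fixes x :: "'a \<Rightarrow> real"
  assumes "finite C"
  shows "(sum x C)\<^sup>2 \<le> card C * (\<Sum>u\<in>C. (x u)\<^sup>2)"
proof (cases "C = {}")
  case False
  define k where "k = real (card C)"
  have k: "k > 0" using False assms by (simp add: k_def card_gt_0_iff)
  \<comment> \<open>Cauchy-Schwarz against the constant vector, read off from the scaled deviations
    from the mean.\<close>
  have "0 \<le> (\<Sum>u\<in>C. (k * x u - sum x C)\<^sup>2)" by (simp add: sum_nonneg)
  also have "\<dots> = k\<^sup>2 * (\<Sum>u\<in>C. (x u)\<^sup>2) - 2 * k * sum x C * sum x C + k * (sum x C)\<^sup>2"
    by (simp add: power2_diff sum.distrib sum_subtractf sum_distrib_left sum_distrib_right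
        power_mult_distrib k_def mult_ac)
  also have "\<dots> = k * (k * (\<Sum>u\<in>C. (x u)\<^sup>2) - (sum x C)\<^sup>2)"
    by (simp add: algebra_simps power2_eq_square)
  finally show ?thesis using k by (simp add: zero_le_mult_iff k_def)
qed simp

text \<open>By Cauchy-Schwarz the off-diagonal products sum to at most \<open>(k - 1) / k\<close>
  times the squared mass, where \<open>k = card C\<close>; this factor cancels the weight bound
  \<open>k / (k - 1)\<close>.\<close>

lemma bform_le_square_sum_complete:
  fixes x :: "'a \<Rightarrow> real"
  assumes "finite C" and x: "\<And>u. u \<in> C \<Longrightarrow> 0 \<le> x u"
    and diag: "\<And>u. a u u = 0"
    and a: "\<And>u v. u \<in> C \<Longrightarrow> v \<in> C \<Longrightarrow> u \<noteq> v \<Longrightarrow> a u v \<le> card C / (card C - 1)"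
  shows "bform a C x x \<le> (sum x C)\<^sup>2"
proof (cases "card C \<le> 1")
  case True
  then have "bform a C x x = 0"
    using \<open>finite C\<close> diag unfolding bform_def
    by (auto simp: card_le_Suc0_iff_eq intro!: sum.neutral)
  then show ?thesis by simp
next
  case False
  define k where "k = real (card C)"
  have k: "k > 1" using False by (simp add: k_def)
  \<comment> \<open>Subtracting the diagonal explicitly makes the bound hold for every pair: both
    sides vanish when \<open>u = v\<close>.\<close>
  have "bform a C x x \<le> (\<Sum>u\<in>C. \<Sum>v\<in>C. k / (k - 1) * (x u * x v - of_bool (v = u) * (x u)\<^sup>2))"
    unfolding bform_def
  proof (intro sum_mono)
    fix u v assume uv: "u \<in> C" "v \<in> C"
    have "a u v * (x u * x v) \<le> k / (k - 1) * (x u * x v)" if "u \<noteq> v"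
      using a[OF uv that] x uv False by (intro mult_right_mono) (auto simp: k_def of_nat_diff)
    then show "a u v * x u * x v \<le> k / (k - 1) * (x u * x v - of_bool (v = u) * (x u)\<^sup>2)"
      using diag by (cases "u = v") (auto simp: power2_eq_square mult_ac)
  qed
  also have "\<dots> = k / (k - 1) * (\<Sum>u\<in>C. \<Sum>v\<in>C. x u * x v - of_bool (v = u) * (x u)\<^sup>2)"
    by (simp add: sum_distrib_left)
  also have "\<dots> = k / (k - 1) * ((sum x C)\<^sup>2 - (\<Sum>u\<in>C. (x u)\<^sup>2))"
    using \<open>finite C\<close>
    by (simp add: sum_subtractf of_bool_def if_distrib[of "\<lambda>c. c * _"] sum_product power2_eq_square cong: if_cong)
  also have "\<dots> \<le> (sum x C)\<^sup>2"
    using square_sum_le_card_mult_sum_squares[OF \<open>finite C\<close>, of x] k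
    by (simp add: field_simps k_def)
  finally show ?thesis .
qed

text \<open>Induction on the size of the support of \<open>x\<close>. A support that is not a clique
  can be shrunk without lowering the form or changing the mass. The weight bound is assumed for
  every clique, so the complete case applies to whichever one remains.\<close>

lemma Motzkin_Straus_weighted:
  fixes x :: "'a \<Rightarrow> real"
  assumes "finite S" and sym: "\<And>u v. a u v = a v u" and diag: "\<And>u. a u u = 0"
    and a: "\<And>C u v. C \<subseteq> S \<Longrightarrow> pairwise (\<lambda>u v. a u v \<noteq> 0) C \<Longrightarrow> u \<in> C \<Longrightarrow> v \<in> C \<Longrightarrow> u \<noteq> v
                \<Longrightarrow> a u v \<le> card C / (card C - 1)"
    and "\<And>u. u \<in> S \<Longrightarrow> 0 \<le> x u"
  shows "bform a S x x \<le> (sum x S)\<^sup>2"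
  using \<open>\<And>u. u \<in> S \<Longrightarrow> 0 \<le> x u\<close>
proof (induction "card {u \<in> S. x u \<noteq> 0}" arbitrary: x rule: less_induct)
  case less
  define C where "C = {u \<in> S. x u \<noteq> 0}"
  show ?case
  proof (cases "pairwise (\<lambda>u v. a u v \<noteq> 0) C")
    case True
    have C: "C \<subseteq> S" "finite C" using \<open>finite S\<close> by (auto simp: C_def)
    have "bform a S x x = bform a C x x"
    proof -
      have "bform a C x x = (\<Sum>u\<in>C. \<Sum>v\<in>S. a u v * x u * x v)"
        unfolding bform_def
        by (intro sum.cong refl sum.mono_neutral_left) (auto simp: C_def \<open>finite S\<close>)
      also have "\<dots> = bform a S x x"
        unfolding bform_def
        by (intro sum.mono_neutral_left) (auto simp: C_def \<open>finite S\<close>)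
      finally show ?thesis by simp
    qed
    also have "\<dots> \<le> (sum x C)\<^sup>2"
      using C less.prems a[OF C(1) True] diag by (intro bform_le_square_sum_complete) auto
    also have "sum x C = sum x S"
      by (intro sum.mono_neutral_left) (auto simp: C_def \<open>finite S\<close>)
    finally show ?thesis .
  next
    case False
    then obtain p q where pq: "p \<in> C" "q \<in> C" "p \<noteq> q" "a p q = 0" "a q p = 0"
      using sym unfolding pairwise_def by metis
    \<comment> \<open>The two non-adjacent vertices are ordered so that moving mass from
      \<open>u\<close> to \<open>v\<close> does not decrease the form.\<close>
    obtain u v where uv: "u \<in> C" "v \<in> C" "u \<noteq> v" "a u v = 0"
      and le: "(\<Sum>w\<in>S. a w u * x w) \<le> (\<Sum>w\<in>S. a w v * x w)"
      using pq by (cases "(\<Sum>w\<in>S. a w p * x w) \<le> (\<Sum>w\<in>S. a w q * x w)")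
        (auto intro: that[of p q] that[of q p])
    have uvS: "u \<in> S" "v \<in> S" using uv by (auto simp: C_def)
    \<comment> \<open>Direction from \<open>u\<close> towards \<open>v\<close>; the step length
      \<open>x u\<close> used below empties \<open>u\<close> exactly.\<close>
    define y :: "'a \<Rightarrow> real" where "y w = of_bool (w = v) + (- 1) * of_bool (w = u)" for w :: 'a
    define x' where "x' w = x w + x u * y w" for w
    \<comment> \<open>Only the diagonal and \<open>a u v\<close> enter here, all zero, so the form
      is linear along \<open>y\<close>.\<close>
    have yy: "bform a S y y = 0"
      unfolding y_def bform_add_left bform_add_right
      using uvS uv \<open>finite S\<close> diag sym[of u v] by (simp add: bform_unit_unit)
    have xy: "bform a S x y \<ge> 0"
      unfolding y_def bform_add_right using le uvS \<open>finite S\<close> by (simp add: bform_unit_right)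
    have "sum y S = 0" using uvS \<open>finite S\<close>
      by (simp add: y_def sum.distrib sum_negf sum_subtractf of_bool_def cong: if_cong)
    then have sum: "sum x' S = sum x S"
      by (simp add: x'_def sum.distrib flip: sum_distrib_left)
    have "x' w \<ge> 0" if "w \<in> S" for w
      using less.prems[OF that] less.prems[OF uvS(1)] \<open>u \<noteq> v\<close> by (auto simp: x'_def y_def)
    \<comment> \<open>The vertex \<open>u\<close> leaves the support, and nothing enters it because
      \<open>v\<close> already belongs to it.\<close>
    moreover have "{w \<in> S. x' w \<noteq> 0} \<subset> {w \<in> S. x w \<noteq> 0}"
      using uv by (auto simp: C_def x'_def y_def of_bool_def split: if_splits)
    then have "card {w \<in> S. x' w \<noteq> 0} < card {w \<in> S. x w \<noteq> 0}"
      using \<open>finite S\<close> by (intro psubset_card_mono) auto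
    ultimately have "bform a S x' x' \<le> (sum x' S)\<^sup>2" using less.hyps by blast
    moreover have "bform a S x' x' = bform a S x x + 2 * x u * bform a S x y"
      unfolding x'_def using sym by (subst bform_line) (auto simp: yy)
    moreover have "2 * x u * bform a S x y \<ge> 0" using xy less.prems[OF uvS(1)] by simp
    ultimately show ?thesis using sum by simp
  qed
qed

section \<open>First- and second-order conditions at an interior maximiser\<close>

lemma quadratic_nonpos_near_0:
  fixes B C e :: real
  assumes "e > 0" and le: "\<And>t. \<bar>t\<bar> < e \<Longrightarrow> 2 * t * B + t\<^sup>2 * C \<le> 0"
  shows "B = 0" "C \<le> 0"
proof -
  \<comment> \<open>Adding the inequalities at \<open>t\<close> and \<open>- t\<close> cancels the
    linear term.\<close>
  have "t\<^sup>2 * C \<le> 0" if "\<bar>t\<bar> < e" for t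
    using le[of t] le[of "- t"] that by simp
  from this[of "e / 2"] show "C \<le> 0" using \<open>e > 0\<close> by (simp add: mult_le_0_iff)
  have nonpos: "B' \<le> 0" if le': "\<And>t. \<bar>t\<bar> < e \<Longrightarrow> 2 * t * B' + t\<^sup>2 * C \<le> 0" for B'
  proof (rule ccontr)
    assume "\<not> B' \<le> 0"
    \<comment> \<open>Small enough to stay in the interval and to keep
      \<open>\<bar>t * C\<bar>\<close> at most \<open>B'\<close>, so the linear term wins; the
      \<open>+ 1\<close> covers \<open>C = 0\<close>.\<close>
    define t where "t = min (e / 2) (B' / (\<bar>C\<bar> + 1))"
    have t: "t > 0" "\<bar>t\<bar> < e" using \<open>\<not> B' \<le> 0\<close> \<open>e > 0\<close> by (auto simp: t_def)
    have "t * (\<bar>C\<bar> + 1) \<le> B'"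
      by (simp add: t_def flip: pos_le_divide_eq)
    then have "- (t * C) \<le> B'"
      using t abs_ge_minus_self[of C] mult_left_mono[of "- C" "\<bar>C\<bar> + 1" t] by simp
    then have "t * (2 * B' + t * C) > 0" using t \<open>\<not> B' \<le> 0\<close> by (intro mult_pos_pos) auto
    then show False using le'[OF t(2)] by (simp add: algebra_simps power2_eq_square)
  qed
  have "- B \<le> 0" 
  proof (rule nonpos)
    fix t assume "\<bar>t\<bar> < e"
    then show "2 * t * - B + t\<^sup>2 * C \<le> 0" using le[of "- t"] by simp
  qed
  with nonpos[OF le] show "B = 0" by simp
qed

text \<open>A direction of zero sum preserves the total mass, and positivity of \<open>x\<close> on
  the finite set \<open>S\<close> permits small steps of either sign. The change of the form along
  \<open>y\<close> is therefore a nonpositive quadratic near 0.\<close>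

lemma bform_interior_maximum:
  assumes "finite S" and sym: "\<And>u v. a u v = a v u"
    and le: "\<And>z. (\<And>u. u \<in> S \<Longrightarrow> 0 \<le> z u) \<Longrightarrow> bform a S z z \<le> (sum z S)\<^sup>2"
    and eq: "bform a S x x = (sum x S)\<^sup>2" and pos: "\<And>u. u \<in> S \<Longrightarrow> 0 < x u"
    and y: "sum y S = 0"
  shows "bform a S x y = 0" "bform a S y y \<le> 0"
proof -
  have "\<forall>u\<in>S. \<forall>\<^sub>F t in at 0. 0 < x u + t * y u"
  proof
    fix u assume "u \<in> S"
    have "((\<lambda>t. x u + t * y u) \<longlongrightarrow> x u + 0 * y u) (at 0)" by (intro tendsto_intros)
    then show "\<forall>\<^sub>F t in at 0. 0 < x u + t * y u"
      using pos[OF \<open>u \<in> S\<close>] by (intro order_tendstoD) auto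
  qed
  then have "\<forall>\<^sub>F t in at 0. \<forall>u\<in>S. 0 < x u + t * y u"
    using \<open>finite S\<close> by (simp add: eventually_ball_finite_distrib)
  then obtain e where e: "e > 0" "\<And>t u. t \<noteq> 0 \<Longrightarrow> \<bar>t\<bar> < e \<Longrightarrow> u \<in> S \<Longrightarrow> 0 < x u + t * y u"
    by (auto simp: eventually_at dist_real_def)
  have "2 * t * bform a S x y + t\<^sup>2 * bform a S y y \<le> 0" if t: "\<bar>t\<bar> < e" for t
  proof (cases "t = 0")
    case False
    have "bform a S (\<lambda>w. x w + t * y w) (\<lambda>w. x w + t * y w) \<le> (\<Sum>w\<in>S. x w + t * y w)\<^sup>2"
      using e(2)[OF False t] by (intro le less_imp_le) auto
    also have "(\<Sum>w\<in>S. x w + t * y w) = sum x S"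
      using y by (simp add: sum.distrib flip: sum_distrib_left)
    finally show ?thesis using eq sym by (subst (asm) bform_line) auto
  qed simp
  from quadratic_nonpos_near_0[OF e(1) this]
  show "bform a S x y = 0" "bform a S y y \<le> 0" by auto
qed

text \<open>First-order condition in the direction that moves mass from \<open>v\<close> to
  \<open>u\<close>. It later yields regularity.\<close>

lemma bform_interior_maximum_row_sums:
  assumes "finite S" and sym: "\<And>u v. a u v = a v u"
    and le: "\<And>z. (\<And>u. u \<in> S \<Longrightarrow> 0 \<le> z u) \<Longrightarrow> bform a S z z \<le> (sum z S)\<^sup>2"
    and eq: "bform a S x x = (sum x S)\<^sup>2" and pos: "\<And>u. u \<in> S \<Longrightarrow> 0 < x u"
    and uv: "u \<in> S" "v \<in> S"
  shows "(\<Sum>w\<in>S. a w u * x w) = (\<Sum>w\<in>S. a w v * x w)"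
proof -
  define y where "y w = of_bool (w = u) + (- 1) * (of_bool (w = v) :: real)" for w :: 'a
  have "sum y S = 0" using uv \<open>finite S\<close>
    by (simp add: y_def sum.distrib sum_negf sum_subtractf of_bool_def cong: if_cong)
  then have "bform a S x y = 0"
    using bform_interior_maximum(1)[OF \<open>finite S\<close> sym le eq pos] by blast
  then show ?thesis
    unfolding y_def bform_add_right using uv \<open>finite S\<close> by (simp add: bform_unit_right)
qed

text \<open>Second-order condition with coefficients 1, 1, -2 at \<open>u\<close>, \<open>w\<close>,
  \<open>v\<close>: the zero entries kill all terms of \<open>bform a S y y\<close> except
  \<open>2 * a u w\<close>. For nonnegative weights this is transitivity of non-adjacency.\<close>

lemma bform_interior_maximum_zero_trans:
  assumes "finite S" and sym: "\<And>u v. a u v = a v u"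
    and le: "\<And>z. (\<And>u. u \<in> S \<Longrightarrow> 0 \<le> z u) \<Longrightarrow> bform a S z z \<le> (sum z S)\<^sup>2"
    and eq: "bform a S x x = (sum x S)\<^sup>2" and pos: "\<And>u. u \<in> S \<Longrightarrow> 0 < x u"
    and diag: "\<And>u. a u u = 0"
    and uvw: "u \<in> S" "v \<in> S" "w \<in> S" "a u v = 0" "a v w = 0"
  shows "a u w \<le> 0"
proof -
  define y where "y z = (of_bool (z = u) + 1 * of_bool (z = w)) + (- 2) * (of_bool (z = v) :: real)" for z :: 'a
  have "sum y S = 0" using uvw \<open>finite S\<close>
    by (simp add: y_def sum.distrib sum_subtractf of_bool_def if_distrib[of "\<lambda>c. _ * c"] cong: if_cong)
  then have "bform a S y y \<le> 0"
    using bform_interior_maximum(2)[OF \<open>finite S\<close> sym le eq pos] by blast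
  then show ?thesis
    unfolding y_def bform_add_right bform_add_left
    using uvw \<open>finite S\<close> diag sym[of v u] sym[of v w] sym[of u w] by (simp add: bform_unit_unit)
qed

section \<open>Cliques and complete multipartite graphs\<close>

context graph
begin

lemma dominates_sym: "u \<rightarrow>\<^bsub>G\<^esub> v \<longleftrightarrow> v \<rightarrow>\<^bsub>G\<^esub> u"
  using arcs_ends_symmetric[OF sym_arcs] by blast

lemma out_degree_eq_card: "out_degree G v = card {u \<in> verts G. v \<rightarrow>\<^bsub>G\<^esub> u}"
proof -
  have "bij_betw (head G) (out_arcs G v) {u \<in> verts G. v \<rightarrow>\<^bsub>G\<^esub> u}"
    unfolding bij_betw_def
  proof
    show "inj_on (head G) (out_arcs G v)"
      by (auto simp: inj_on_def arc_to_ends_def intro!: no_multi_arcs)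
    show "head G ` out_arcs G v = {u \<in> verts G. v \<rightarrow>\<^bsub>G\<^esub> u}"
      by (auto simp: arcs_ends_conv image_iff)
  qed
  then show ?thesis unfolding out_degree_def by (rule bij_betw_same_card)
qed

lemma out_degree_eq_0_iff: "out_degree G v = 0 \<longleftrightarrow> (\<forall>u. \<not> v \<rightarrow>\<^bsub>G\<^esub> u)"
  by (auto simp: out_degree_eq_card dest: adj_in_verts)

text \<open>The indicator form turns weighted degree sums into double sums whose order can be
  exchanged.\<close>

lemma out_degree_eq_sum:
  assumes "\<And>u. v \<rightarrow>\<^bsub>G\<^esub> u \<Longrightarrow> u \<in> S" "S \<subseteq> verts G"
  shows "real (out_degree G v) = (\<Sum>u\<in>S. of_bool (v \<rightarrow>\<^bsub>G\<^esub> u))"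
proof -
  have "finite S" using assms(2) finite_verts by (rule finite_subset)
  have "{u \<in> verts G. v \<rightarrow>\<^bsub>G\<^esub> u} = {u \<in> S. v \<rightarrow>\<^bsub>G\<^esub> u}" using assms by auto
  then show ?thesis using \<open>finite S\<close>
    by (simp add: out_degree_eq_card of_bool_def sum.If_cases Int_def)
qed

lemma dominates_induce_subgraph_iff: "u \<rightarrow>\<^bsub>G \<restriction> X\<^esub> v \<longleftrightarrow> u \<in> X \<and> v \<in> X \<and> u \<rightarrow>\<^bsub>G\<^esub> v"
  by (auto simp: arcs_ends_conv)

lemma out_degree_induce_subgraph:
  assumes "\<And>u. v \<rightarrow>\<^bsub>G\<^esub> u \<Longrightarrow> u \<in> X" "v \<in> X"
  shows "out_degree (G \<restriction> X) v = out_degree G v"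
proof -
  have "out_arcs (G \<restriction> X) v = out_arcs G v"
    using assms by (auto simp: arcs_ends_conv)
  then show ?thesis by (simp add: out_degree_def)
qed

lemma finite_clique_cards: "finite {card C |C. clique G C \<and> v \<in> C}"
proof (rule finite_subset)
  show "{card C |C. clique G C \<and> v \<in> C} \<subseteq> card ` Pow (verts G)"
    by (auto simp: clique_def)
qed auto

lemma card_clique_le_cl: "clique G C \<Longrightarrow> v \<in> C \<Longrightarrow> card C \<le> cl G v"
  unfolding cl_def by (intro Max_ge finite_clique_cards) auto

lemma clique_dominates: "clique G C \<Longrightarrow> u \<in> C \<Longrightarrow> v \<in> C \<Longrightarrow> u \<noteq> v \<Longrightarrow> u \<rightarrow>\<^bsub>G\<^esub> v"
  by (auto simp: clique_def pairwise_def)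

lemma cl_eqI:
  assumes "clique G C" "v \<in> C" "card C = k"
    and "\<And>D. clique G D \<Longrightarrow> v \<in> D \<Longrightarrow> card D \<le> k"
  shows "cl G v = k"
  unfolding cl_def using assms by (intro Max_eqI finite_clique_cards) auto

lemma cl_isolated:
  assumes "v \<in> verts G" "out_degree G v = 0"
  shows "cl G v = 1"
proof (rule cl_eqI)
  show "clique G {v}" using assms by (simp add: clique_def pairwise_def)
  fix D assume D: "clique G D" "v \<in> D"
  then have "D = {v}" using assms(2) clique_dominates by (auto simp: out_degree_eq_0_iff)
  then show "card D \<le> 1" by simp
qed auto

lemma two_le_cl:
  assumes "u \<rightarrow>\<^bsub>G\<^esub> v"
  shows "2 \<le> cl G u"
proof -
  have "clique G {u, v}" "u \<noteq> v"
    using assms adj_in_verts[OF assms] dominates_sym adj_not_same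
    by (auto simp: clique_def pairwise_def)
  then show ?thesis using card_clique_le_cl[of "{u, v}" u] by simp
qed

text \<open>One vertex from each part gives a clique, and no clique meets a part twice. Letting
  \<open>S\<close> omit isolated vertices serves both directions of the equality case.\<close>

lemma cl_eq_card_parts:
  assumes P: "partition_on S P"
    and S: "S \<subseteq> verts G" "verts G - S \<subseteq> isolated_verts G"
    and adj: "\<And>u v. u \<in> S \<Longrightarrow> v \<in> S \<Longrightarrow> u \<rightarrow>\<^bsub>G\<^esub> v \<longleftrightarrow> \<not> (\<exists>A\<in>P. u \<in> A \<and> v \<in> A)"
    and v: "v \<in> S"
  shows "cl G v = card P"
proof -
  have "finite S" using S(1) finite_verts by (rule finite_subset)
  then have "finite P" using P by (rule finite_elements)
  have US: "\<Union> P = S" and ne: "{} \<notin> P"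
    and disj: "\<And>A B w. A \<in> P \<Longrightarrow> B \<in> P \<Longrightarrow> w \<in> A \<Longrightarrow> w \<in> B \<Longrightarrow> A = B"
    using P by (auto simp: partition_on_def disjoint_def)
  obtain V where V: "V \<in> P" "v \<in> V" using US v by auto
  \<comment> \<open>The representative of the part of \<open>v\<close> is \<open>v\<close> itself,
    so that the transversal is a clique through \<open>v\<close>.\<close>
  define g where "g A = (if A = V then v else SOME w. w \<in> A)" for A
  have g: "g A \<in> A" if "A \<in> P" for A
    using that V ne by (auto simp: g_def some_in_eq)
  have inj: "inj_on g P" using g disj by (metis inj_onI)
  show ?thesis
  proof (rule cl_eqI)
    have "g A \<rightarrow>\<^bsub>G\<^esub> g B" if "A \<in> P" "B \<in> P" "g A \<noteq> g B" for A B
      using that g[of A] g[of B] US disj by (subst adj) blast+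
    moreover have "g A \<in> verts G" if "A \<in> P" for A
      using g[OF that] that US S(1) by blast
    ultimately show "clique G (g ` P)"
      by (auto simp: clique_def pairwise_def)
    show "v \<in> g ` P" using V by (auto simp: g_def intro!: image_eqI[of _ _ V])
    show "card (g ` P) = card P" using inj by (rule card_image)
    fix D assume D: "clique G D" "v \<in> D"
    \<comment> \<open>A clique member outside \<open>S\<close> would be isolated and yet adjacent to
      \<open>v\<close>.\<close>
    have "w \<in> S" if "w \<in> D" for w
    proof (rule ccontr)
      assume "w \<notin> S"
      then have "w \<rightarrow>\<^bsub>G\<^esub> v" using clique_dominates[OF D(1) \<open>w \<in> D\<close> D(2)] v by auto
      moreover have "w \<in> isolated_verts G" using D \<open>w \<in> D\<close> \<open>w \<notin> S\<close> S by (auto simp: clique_def)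
      ultimately show False by (auto simp: isolated_verts_def out_degree_eq_0_iff)
    qed
    then have "\<forall>w\<in>D. \<exists>A\<in>P. w \<in> A" using US by auto
    then obtain h where h: "\<And>w. w \<in> D \<Longrightarrow> h w \<in> P \<and> w \<in> h w" by metis
    have "inj_on h D"
    proof (rule inj_onI, rule ccontr)
      fix w z assume wz: "w \<in> D" "z \<in> D" "h w = h z" "w \<noteq> z"
      then show False
        using h[of w] h[of z] clique_dominates[OF D(1), of w z] adj[of w z] \<open>\<And>w. w \<in> D \<Longrightarrow> w \<in> S\<close>
        by auto
    qed
    then show "card D \<le> card P" using h \<open>finite P\<close> by (intro card_inj_on_le[of h]) auto
  qed
qed

end

section \<open>The weighted degree inequality and its equality case\<close>

theorem theorem1p6:
  fixes G :: "('a, 'b) pre_digraph"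
  assumes "graph G"
  shows "(\<Sum>v\<in>verts G. real (out_degree G v) * ((real (cl G v) - 1) / real (cl G v)))
           \<le> (\<Sum>v\<in>verts G. (real (cl G v) - 1) / real (cl G v))\<^sup>2
       \<and> ((\<Sum>v\<in>verts G. real (out_degree G v) * ((real (cl G v) - 1) / real (cl G v)))
           = (\<Sum>v\<in>verts G. (real (cl G v) - 1) / real (cl G v))\<^sup>2
         \<longleftrightarrow> up_to_isolated_verts (\<lambda>H. complete_multipartite H \<and> regular H) G)"
proof -
  interpret graph G by fact
  define f where "f v = (real (cl G v) - 1) / real (cl G v)" for v
  \<comment> \<open>On the non-isolated vertices \<open>f\<close> is positive, so the edge weights
    are genuine and \<open>f\<close> is an interior point; elsewhere \<open>f\<close> is 0 and both
    sums are unaffected.\<close>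
  define S where "S = {v \<in> verts G. out_degree G v \<noteq> 0}"
  define a where "a u v = (if u \<rightarrow>\<^bsub>G\<^esub> v then 1 / min (f u) (f v) else 0)" for u v
  have S: "finite S" "S \<subseteq> verts G" and iso: "verts G - S = isolated_verts G"
    by (auto simp: S_def isolated_verts_def)
  have adjS: "u \<in> S \<and> v \<in> S" if "u \<rightarrow>\<^bsub>G\<^esub> v" for u v
    using that dominates_sym adj_in_verts[OF that] by (auto simp: S_def out_degree_eq_0_iff)
  have deg: "real (out_degree G v) = (\<Sum>u\<in>S. of_bool (v \<rightarrow>\<^bsub>G\<^esub> u))" for v
    using adjS S by (intro out_degree_eq_sum) auto
  have f_pos: "f v > 0" if v: "v \<in> S" for v
  proof -
    have "\<exists>u. v \<rightarrow>\<^bsub>G\<^esub> u" using v by (simp add: S_def out_degree_eq_0_iff)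
    then obtain u where "v \<rightarrow>\<^bsub>G\<^esub> u" ..
    from two_le_cl[OF this] show ?thesis by (simp add: f_def)
  qed
  have f_iso: "f v = 0" if "v \<in> verts G - S" for v
    using that cl_isolated[of v] by (simp add: f_def S_def)
  have sum_f: "sum f (verts G) = sum f S"
    using S f_iso by (intro sum.mono_neutral_right) auto
  have sum_df: "(\<Sum>v\<in>verts G. real (out_degree G v) * f v) = (\<Sum>v\<in>S. real (out_degree G v) * f v)"
    using S f_iso by (intro sum.mono_neutral_right) auto
  have a_sym: "a u v = a v u" and a_diag: "a u u = 0" for u v
    using dominates_sym[of u v] adj_not_same by (auto simp: a_def min.commute)
  have a_0: "a u v \<le> 0 \<longleftrightarrow> \<not> u \<rightarrow>\<^bsub>G\<^esub> v" and a_eq_0: "a u v = 0 \<longleftrightarrow> \<not> u \<rightarrow>\<^bsub>G\<^esub> v" for u v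
    using adjS[of u v] f_pos[of u] f_pos[of v] by (auto simp: a_def min_def)
  \<comment> \<open>Every vertex of a clique of size \<open>k\<close> has \<open>cl\<close> at least
    \<open>k\<close>, hence \<open>f\<close> at least \<open>(k - 1) / k\<close>; the reciprocal of
    the minimum is then at most \<open>k / (k - 1)\<close>.\<close>
  have a_le: "a u v \<le> card C / (card C - 1)"
    if C: "C \<subseteq> S" "pairwise (\<lambda>u v. a u v \<noteq> 0) C" and uv: "u \<in> C" "v \<in> C" "u \<noteq> v" for C u v
  proof -
    have clq: "clique G C" using C S by (auto simp: clique_def pairwise_def a_eq_0)
    have "finite C" using C(1) S(1) by (rule finite_subset)
    then have "card {u, v} \<le> card C" using uv by (intro card_mono) auto
    then have k: "2 \<le> card C" using uv by simp
    have ge: "(real (card C) - 1) / card C \<le> f w" if "w \<in> C" for w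
    proof -
      have "card C \<le> cl G w" using card_clique_le_cl[OF clq that] .
      then show ?thesis using k by (simp add: f_def field_simps)
    qed
    have "a u v = 1 / min (f u) (f v)"
      using clique_dominates[OF clq uv] by (simp add: a_def)
    also have "\<dots> \<le> 1 / ((real (card C) - 1) / card C)"
      using ge uv k by (intro divide_left_mono mult_pos_pos) (auto intro: less_le_trans[OF _ ge])
    finally show ?thesis using k by (simp add: of_nat_diff)
  qed
  have MS: "bform a S z z \<le> (sum z S)\<^sup>2" if "\<And>u. u \<in> S \<Longrightarrow> 0 \<le> z u" for z
    by (rule Motzkin_Straus_weighted[OF S(1) a_sym a_diag a_le that])
  have MS_f: "bform a S f f \<le> (sum f S)\<^sup>2"
    using f_pos by (intro MS) (simp add: less_imp_le)
  have lower: "(\<Sum>v\<in>S. real (out_degree G v) * f v) \<le> bform a S f f"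
  proof -
    have "(\<Sum>v\<in>S. real (out_degree G v) * f v) = (\<Sum>v\<in>S. \<Sum>u\<in>S. of_bool (v \<rightarrow>\<^bsub>G\<^esub> u) * f v)"
      by (simp add: deg sum_distrib_right)
    \<comment> \<open>Exchanging the sums reads each edge from its other end; averaging both
      readings replaces \<open>f v\<close> by \<open>(f v + f u) / 2\<close>.\<close>
    moreover have "\<dots> = (\<Sum>v\<in>S. \<Sum>u\<in>S. of_bool (v \<rightarrow>\<^bsub>G\<^esub> u) * f u)"
      by (subst sum.swap) (simp add: dominates_sym)
    ultimately have "(\<Sum>v\<in>S. real (out_degree G v) * f v)
        = (\<Sum>v\<in>S. \<Sum>u\<in>S. of_bool (v \<rightarrow>\<^bsub>G\<^esub> u) * ((f v + f u) / 2))"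
      by (simp add: field_simps sum.distrib flip: sum_divide_distrib)
    also have "\<dots> \<le> bform a S f f"
      unfolding bform_def
    proof (intro sum_mono)
      fix v u assume "v \<in> S" "u \<in> S"
      then show "of_bool (v \<rightarrow>\<^bsub>G\<^esub> u) * ((f v + f u) / 2) \<le> a v u * f v * f u"
        using f_pos[of u] f_pos[of v] by (auto simp: a_def min_def field_simps)
    qed
    finally show ?thesis .
  qed

  have multipartite: "up_to_isolated_verts (\<lambda>H. complete_multipartite H \<and> regular H) G"
    if eq: "(\<Sum>v\<in>S. real (out_degree G v) * f v) = (sum f S)\<^sup>2"
  proof -
    \<comment> \<open>The form is squeezed between the degree sum and the squared mass, so
      \<open>f\<close> attains the Motzkin-Straus bound.\<close>
    have max: "bform a S f f = (sum f S)\<^sup>2" using eq lower MS_f by simp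
    have trans: "\<not> u \<rightarrow>\<^bsub>G\<^esub> w"
      if "u \<in> S" "v \<in> S" "w \<in> S" "\<not> u \<rightarrow>\<^bsub>G\<^esub> v" "\<not> v \<rightarrow>\<^bsub>G\<^esub> w" for u v w
      using bform_interior_maximum_zero_trans[where a = a, OF S(1) a_sym MS max f_pos a_diag, of u v w] that
      by (simp add: a_0 a_eq_0)
    \<comment> \<open>Non-adjacency, reflexive because there are no loops; its classes are the
      parts.\<close>
    define R where "R = {(u, v) \<in> S \<times> S. \<not> u \<rightarrow>\<^bsub>G\<^esub> v}"
    have R: "equiv S R"
    proof (rule equivI)
      show "R \<subseteq> S \<times> S" by (auto simp: R_def)
      show "refl_on S R" using adj_not_same by (auto simp: R_def refl_on_def)
      show "sym R" using dominates_sym by (auto simp: R_def sym_def)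
      show "Relation.trans R" using trans by (auto simp: R_def intro!: transI)
    qed
    define P where "P = S // R"
    have P: "partition_on S P" unfolding P_def using R by (rule partition_on_quotient)
    have adj: "u \<rightarrow>\<^bsub>G\<^esub> v \<longleftrightarrow> \<not> (\<exists>A\<in>P. u \<in> A \<and> v \<in> A)" if "u \<in> S" "v \<in> S" for u v
    proof -
      have "(\<exists>A\<in>P. u \<in> A \<and> v \<in> A) \<longleftrightarrow> (u, v) \<in> R"
        using that R unfolding P_def
        by (metis equiv_class_eq_iff equiv_class_self in_quotient_imp_in_rel insert_subset empty_subsetI quotientI)
      then show ?thesis using that by (simp add: R_def)
    qed
    define c where "c = (real (card P) - 1) / card P"
    have f_c: "f v = c" if "v \<in> S" for v
      using cl_eq_card_parts[OF P S(2) _ adj that] iso by (simp add: f_def c_def)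
    \<comment> \<open>Since \<open>f\<close> has the constant value \<open>c\<close> on
      \<open>S\<close>, each edge weight is \<open>1 / c\<close> and cancels the factor
      \<open>f w\<close>.\<close>
    have row: "(\<Sum>w\<in>S. a w v * f w) = real (out_degree G v)" if "v \<in> S" for v
      unfolding deg
    proof (intro sum.cong refl)
      fix w assume "w \<in> S"
      then show "a w v * f w = of_bool (v \<rightarrow>\<^bsub>G\<^esub> w)"
        using that f_c f_pos[of v] dominates_sym[of v w] by (simp add: a_def)
    qed
    have reg: "out_degree G u = out_degree G v" if "u \<in> S" "v \<in> S" for u v
      using bform_interior_maximum_row_sums[where a = a, OF S(1) a_sym MS max f_pos that] row that by simp
    have VS: "verts G - (verts G - S) = S" using S by auto
    have "complete_multipartite (G \<restriction> S)"
      unfolding complete_multipartite_def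
      using P adj by (auto simp: dominates_induce_subgraph_iff intro!: exI[of _ P])
    moreover have "regular (G \<restriction> S)"
    proof (cases "S = {}")
      case False
      then obtain w where "w \<in> S" by blast
      then have "out_degree (G \<restriction> S) v = out_degree G w" if "v \<in> S" for v
        using reg[OF that] out_degree_induce_subgraph[of v S] adjS that by metis
      then show ?thesis by (auto simp: regular_def)
    qed (simp add: regular_def)
    ultimately show ?thesis
      unfolding up_to_isolated_verts_def using iso VS by (intro exI[of _ "verts G - S"]) simp
  qed

  have equality: "(\<Sum>v\<in>verts G. real (out_degree G v) * f v) = (sum f (verts G))\<^sup>2"
    if "up_to_isolated_verts (\<lambda>H. complete_multipartite H \<and> regular H) G"
  proof -
    obtain I where I: "I \<subseteq> isolated_verts G" "complete_multipartite (G \<restriction> (verts G - I))"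
      "regular (G \<restriction> (verts G - I))"
      using \<open>up_to_isolated_verts _ G\<close> by (auto simp: up_to_isolated_verts_def)
    \<comment> \<open>\<open>I\<close> need not contain all isolated vertices, so \<open>T\<close>
      lies between \<open>S\<close> and \<open>verts G\<close>; outside \<open>T\<close> the value
      of \<open>f\<close> is 0.\<close>
    define T where "T = verts G - I"
    have T: "finite T" "T \<subseteq> verts G" "verts G - T \<subseteq> isolated_verts G" "S \<subseteq> T"
      using I by (auto simp: T_def S_def isolated_verts_def)
    obtain P where P: "partition_on T P"
      and adj: "\<And>u v. u \<in> T \<Longrightarrow> v \<in> T \<Longrightarrow> u \<rightarrow>\<^bsub>G\<^esub> v \<longleftrightarrow> \<not> (\<exists>A\<in>P. u \<in> A \<and> v \<in> A)"
      using I(2) by (auto simp: complete_multipartite_def dominates_induce_subgraph_iff T_def)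
    \<comment> \<open>All neighbours of a vertex lie in \<open>S\<close> and hence in
      \<open>T\<close>, so degrees survive the restriction.\<close>
    have "\<And>v. v \<in> T \<Longrightarrow> out_degree (G \<restriction> T) v = out_degree G v"
      using adjS T by (intro out_degree_induce_subgraph) auto
    then obtain k where k: "\<And>v. v \<in> T \<Longrightarrow> out_degree G v = k"
      using I(3) by (auto simp: regular_def T_def)
    define r where "r = card P"
    have cl: "cl G v = r" if "v \<in> T" for v
      using cl_eq_card_parts[OF P T(2,3) adj that] by (simp add: r_def)
    \<comment> \<open>A vertex of \<open>A\<close> is adjacent to exactly \<open>T - A\<close>, so
      all parts have the same size; the additive form avoids natural subtraction.\<close>
    have part: "card A + k = card T" if "A \<in> P" for A
    proof -
      have "A \<subseteq> T" "A \<noteq> {}" using P that by (auto simp: partition_on_def)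
      then obtain v where v: "v \<in> A" "v \<in> T" by auto
      have "{u \<in> verts G. v \<rightarrow>\<^bsub>G\<^esub> u} = T - A"
      proof -
        have "v \<rightarrow>\<^bsub>G\<^esub> u \<longleftrightarrow> u \<notin> A" if "u \<in> T" for u
          using adj[OF v(2) that] P v \<open>A \<in> P\<close> by (auto simp: partition_on_def disjoint_def)
        then show ?thesis using adjS T by blast
      qed
      then have "k = card (T - A)" using k[OF v(2)] by (simp add: out_degree_eq_card)
      then show ?thesis
        using \<open>A \<subseteq> T\<close> T(1) by (simp add: card_Diff_subset finite_subset card_mono)
    qed
    have "card T = (\<Sum>A\<in>P. card A)"
      using P T(1) by (metis card_Union_disjoint finite_subset Union_upper partition_on_def
          disjoint_def pairwise_def disjnt_def)
    \<comment> \<open>Summing over the \<open>r\<close> parts gives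
      \<open>k = card T * (r - 1) / r\<close> for positive \<open>r\<close>, which is what equality
      requires.\<close>
    then have "card T + r * k = (\<Sum>A\<in>P. card A + k)"
      by (simp add: sum.distrib r_def)
    also have "\<dots> = r * card T"
      using part by (simp add: r_def)
    finally have rk: "real (card T) * (real r - 1) = real r * real k"
      by (simp add: algebra_simps flip: of_nat_mult of_nat_add)
    have "sum f (verts G) = sum f T"
      using T f_iso by (intro sum.mono_neutral_right) auto
    also have "\<dots> = real (card T) * ((real r - 1) / real r)"
      by (simp add: f_def cl)
    finally have sum_f_T: "sum f (verts G) = real (card T) * ((real r - 1) / real r)" .
    have "(\<Sum>v\<in>verts G. real (out_degree G v) * f v) = (\<Sum>v\<in>T. real (out_degree G v) * f v)"
      using T f_iso by (intro sum.mono_neutral_right) auto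
    also have "\<dots> = real (card T) * (real k * ((real r - 1) / real r))"
      by (simp add: f_def cl k)
    \<comment> \<open>For \<open>r = 0\<close> both sides are 0, as division by zero yields
      0.\<close>
    also have "\<dots> = (real (card T) * ((real r - 1) / real r))\<^sup>2"
      using rk by (cases "r = 0") (auto simp: field_simps power2_eq_square)
    finally show ?thesis using sum_f_T by simp
  qed
  have "(\<Sum>v\<in>verts G. real (out_degree G v) * f v) \<le> (sum f (verts G))\<^sup>2"
    using lower MS_f by (simp add: sum_f sum_df)
  moreover have "(\<Sum>v\<in>verts G. real (out_degree G v) * f v) = (sum f (verts G))\<^sup>2
      \<longleftrightarrow> up_to_isolated_verts (\<lambda>H. complete_multipartite H \<and> regular H) G"
    using equality multipartite by (auto simp: sum_f sum_df)
  ultimately show ?thesis by (simp add: f_def)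
qed

end
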